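(* Let $A,B\in\mathrm{SL}(2,\mathbb H)$ be such that both $A$ and the commutator $[A,B]=ABA^{-1}B^{-1}$ are strictly hyperbolic. If $\langle A,B\rangle$ is a non-elementary discrete subgroup of $\mathrm{SL}(2,\mathbb H)$, then $$|\delta_A^2-4|+|\delta_{ABA^{-1}B^{-1}}-2|\ \ge\ 1.$$
   Context: $\mathbb H$ is the division ring of real quaternions. For $q=q_0+q_1i+q_2j+q_3k\in\mathbb H$ ($q_0,\dots,q_3\in\mathbb R$): $\Re q=q_0$, $\overline q=q_0-q_1i-q_2j-q_3k$, $|q|=\sqrt{q_0^2+q_1^2+q_2^2+q_3^2}$. For a $2\times2$ quaternionic matrix $M=\begin{pmatrix}a&b\\c&d\end{pmatrix}$, $\det M=\sqrt{|a|^2|d|^2+|b|^2|c|^2-2\Re(a\overline c d\overline b)}$ (which equals $|ad-aca^{-1}b|$ when $a\ne0$); $\mathrm{SL}(2,\mathbb H)$ is the group of such matrices with $\det=1$. Put $\delta_M=\Re(a+d)$; this is a conjugacy invariant on $\mathrm{SL}(2,\mathbb H)$. The group acts on $\widehat{\mathbb H}=\mathbb H\cup\{\infty\}$ by $Z\mapsto(aZ+b)(cZ+d)^{-1}$, and by Poincaré extension on hyperbolic 5-space $\mathbf H^5$ (with boundary $\widehat{\mathbb H}$) by orientation-preserving isometries. A subgroup is elementary if it has a finite orbit in $\mathbf H^5\cup\widehat{\mathbb H}$, and non-elementary otherwise. An element of $\mathrm{SL}(2,\mathbb H)$ is strictly hyperbolic (a stretch) if it is conjugate in $\mathrm{SL}(2,\mathbb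 H)$ to a diagonal matrix whose diagonal entries are real numbers different from $0,1,-1$.
   Formalization: In "strictly hyperbolic" the two real diagonal entries are also required to have positive product, so the matrix is diag(r, 1/r); if diag(r, -1/r) is allowed, the inequality fails, e.g. for A = diag(1+√2, 1-√2), B = (1/4)[[√17, 1], [-1, -√17]]. *)

theory Defs
  imports "HOL-Analysis.Analysis" "HOL-Algebra.Generated_Groups"
begin

section \<open>Quaternions\<close>

datatype quat = Quat (qRe: real) (qI: real) (qJ: real) (qK: real)

lemma quat_eq_iff: "p = q \<longleftrightarrow> qRe p = qRe q \<and> qI p = qI q \<and> qJ p = qJ q \<and> qK p = qK q"
  by (cases p; cases q) simp

definition qcnj :: "quat \<Rightarrow> quat"
  where "qcnj q = Quat (qRe q) (- qI q) (- qJ q) (- qK q)"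

instantiation quat :: real_vector
begin

definition "0 = Quat 0 0 0 0"
definition "p + q = Quat (qRe p + qRe q) (qI p + qI q) (qJ p + qJ q) (qK p + qK q)"
definition "- p = Quat (- qRe p) (- qI p) (- qJ p) (- qK p)"
definition "p - q = Quat (qRe p - qRe q) (qI p - qI q) (qJ p - qJ q) (qK p - qK q)"
definition "r *\<^sub>R p = Quat (r * qRe p) (r * qI p) (r * qJ p) (r * qK p)"

instance
  by standard
     (simp_all add: quat_eq_iff zero_quat_def plus_quat_def uminus_quat_def minus_quat_def
        scaleR_quat_def algebra_simps)

end

instantiation quat :: real_inner
begin

definition "inner p q = qRe p * qRe q + qI p * qI q + qJ p * qJ q + qK p * qK q"
definition "norm p = sqrt ((qRe p)\<^sup>2 + (qI p)\<^sup>2 + (qJ p)\<^sup>2 + (qK p)\<^sup>2)"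
definition "sgn p = p /\<^sub>R norm (p :: quat)"
definition "dist p q = norm (p - q :: quat)"
definition "(uniformity :: (quat \<times> quat) filter) = (INF e\<in>{0<..}. principal {(x, y). dist x y < e})"
definition "open (U :: quat set) \<longleftrightarrow> (\<forall>x\<in>U. eventually (\<lambda>(x', y). x' = x \<longrightarrow> y \<in> U) uniformity)"

instance
proof
  fix p q r :: quat and s t :: real
  show "inner p p = 0 \<longleftrightarrow> p = 0"
    by (simp add: inner_quat_def zero_quat_def quat_eq_iff)
       (smt (verit) not_real_square_gt_zero zero_le_square)
  show "0 \<le> inner p p" by (simp add: inner_quat_def)
  show "norm p = sqrt (inner p p)"
    by (simp add: norm_quat_def inner_quat_def power2_eq_square)
qed (simp_all add: plus_quat_def scaleR_quat_def inner_quat_def sgn_quat_def dist_quat_def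
      uniformity_quat_def open_quat_def algebra_simps)

end

instantiation quat :: real_normed_div_algebra
begin

definition "1 = Quat 1 0 0 0"
definition "p * q = Quat
  (qRe p * qRe q - qI p * qI q - qJ p * qJ q - qK p * qK q)
  (qRe p * qI q + qI p * qRe q + qJ p * qK q - qK p * qJ q)
  (qRe p * qJ q - qI p * qK q + qJ p * qRe q + qK p * qI q)
  (qRe p * qK q + qI p * qJ q - qJ p * qI q + qK p * qRe q)"
definition "inverse p = qcnj p /\<^sub>R ((norm p)\<^sup>2)"
definition "p div q = p * inverse (q :: quat)"

instance
proof
  fix p q r :: quat and s :: real
  have norm2: "(norm x)\<^sup>2 = (qRe x)\<^sup>2 + (qI x)\<^sup>2 + (qJ x)\<^sup>2 + (qK x)\<^sup>2" for x :: quat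
    by (simp add: norm_quat_def)
  have left: "qcnj x * x = (norm x)\<^sup>2 *\<^sub>R 1" and right: "x * qcnj x = (norm x)\<^sup>2 *\<^sub>R 1" for x
    unfolding norm2
    by (simp_all add: times_quat_def qcnj_def scaleR_quat_def one_quat_def power2_eq_square)
  have sl: "(s *\<^sub>R x) * y = s *\<^sub>R (x * y)" and sr: "x * (s *\<^sub>R y) = s *\<^sub>R (x * y)"
    for x y :: quat and s
    by (simp_all add: times_quat_def scaleR_quat_def algebra_simps)
  show "(s *\<^sub>R p) * q = s *\<^sub>R (p * q)" "p * (s *\<^sub>R q) = s *\<^sub>R (p * q)"
    by (rule sl, rule sr)
  show "p * q * r = p * (q * r)" "1 * p = p" "p * 1 = p"
    "(p + q) * r = p * r + q * r" "p * (q + r) = p * q + p * r"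
    by (simp_all add: times_quat_def plus_quat_def one_quat_def algebra_simps)
  show "(0::quat) \<noteq> 1" by (simp add: zero_quat_def one_quat_def)
  show "inverse p * p = 1" "p * inverse p = 1" if "p \<noteq> 0"
    using that by (simp_all add: inverse_quat_def sl sr left right)
  show "inverse (0::quat) = 0"
    by (simp add: inverse_quat_def)
  show "p div q = p * inverse q" by (rule divide_quat_def)
  have "(norm (p * q))\<^sup>2 = (norm p * norm q)\<^sup>2"
    unfolding power_mult_distrib norm2 times_quat_def quat.sel by algebra
  then show "norm (p * q) = norm p * norm q"
    by (simp add: power2_eq_iff_nonneg)
qed

end


section \<open>The group of quaternionic 2 by 2 matrices of determinant 1\<close>

text \<open>The library's \<^const>\<open>det\<close> needs commutative entries; this is the Dieudonne determinant.\<close>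

definition qdet :: "quat^2^2 \<Rightarrow> real" where
  "qdet M = (let a = M$1$1; b = M$1$2; c = M$2$1; d = M$2$2 in
     sqrt ((norm a)\<^sup>2 * (norm d)\<^sup>2 + (norm b)\<^sup>2 * (norm c)\<^sup>2 - 2 * qRe (a * qcnj c * d * qcnj b)))"

definition SL2H :: "(quat^2^2) monoid" where
  "SL2H = \<lparr>carrier = {M. qdet M = 1}, monoid.mult = (**), one = mat 1\<rparr>"

definition commutator :: "quat^2^2 \<Rightarrow> quat^2^2 \<Rightarrow> quat^2^2" where
  "commutator A B = A \<otimes>\<^bsub>SL2H\<^esub> B \<otimes>\<^bsub>SL2H\<^esub> inv\<^bsub>SL2H\<^esub> A \<otimes>\<^bsub>SL2H\<^esub> inv\<^bsub>SL2H\<^esub> B"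

definition delta :: "quat^2^2 \<Rightarrow> real" where
  "delta M = qRe (M$1$1 + M$2$2)"

definition qdiag :: "quat \<Rightarrow> quat \<Rightarrow> quat^2^2" where
  "qdiag p q = vector [vector [p, 0], vector [0, q]]"

text \<open>
  A matrix with real diagonal entries \<open>r\<close>, \<open>s\<close> acts by \<open>Z \<mapsto> (r / s) Z\<close>, and \<open>\<bar>r * s\<bar> = 1\<close> by the
  determinant condition. It is a stretch only if \<open>r / s > 0\<close>: for \<open>s = - 1 / r\<close> the action is
  \<open>Z \<mapsto> - r\<^sup>2 Z\<close>, a stretch composed with the rotation \<open>Z \<mapsto> - Z\<close>. Hence the condition
  \<open>r * s > 0\<close>.
\<close>

definition strictly_hyperbolic :: "quat^2^2 \<Rightarrow> bool" where
  "strictly_hyperbolic M \<longleftrightarrow>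
     (\<exists>P r s. P \<in> carrier SL2H \<and> qdiag (of_real r) (of_real s) \<in> carrier SL2H \<and>
        r \<notin> {0, 1, -1} \<and> s \<notin> {0, 1, -1} \<and> r * s > 0 \<and>
        M = P \<otimes>\<^bsub>SL2H\<^esub> qdiag (of_real r) (of_real s) \<otimes>\<^bsub>SL2H\<^esub> inv\<^bsub>SL2H\<^esub> P)"


section \<open>The action on hyperbolic 5-space and its boundary\<close>

text \<open>The boundary is \<^typ>\<open>quat option\<close>, with \<^const>\<open>None\<close> for the point at infinity.\<close>

definition moebius :: "quat^2^2 \<Rightarrow> quat option \<Rightarrow> quat option" where
  "moebius M z = (let a = M$1$1; b = M$1$2; c = M$2$1; d = M$2$2 in
     case z of
       None \<Rightarrow> if c = 0 then None else Some (a * inverse c)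
     | Some Z \<Rightarrow> if c * Z + d = 0 then None else Some ((a * Z + b) * inverse (c * Z + d)))"

text \<open>The upper half-space model: the quaternions times the positive reals.\<close>

definition hyp5 :: "(quat \<times> real) set" where
  "hyp5 = {p. snd p > 0}"

text \<open>
  The Poincare extension in coordinates, for matrices of determinant 1. At height \<open>t = 0\<close> the first
  component is \<open>(a Z + b) (c Z + d)\<^sup>-\<^sup>1\<close>.
\<close>

definition poincare_ext :: "quat^2^2 \<Rightarrow> quat \<times> real \<Rightarrow> quat \<times> real" where
  "poincare_ext M p = (let a = M$1$1; b = M$1$2; c = M$2$1; d = M$2$2; Z = fst p; t = snd p;
       N = (norm (c * Z + d))\<^sup>2 + (norm c)\<^sup>2 * t\<^sup>2 in
     (((a * Z + b) * qcnj (c * Z + d) + t\<^sup>2 *\<^sub>R (a * qcnj c)) /\<^sub>R N, t / N))"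

definition elementary :: "(quat^2^2) set \<Rightarrow> bool" where
  "elementary G \<longleftrightarrow>
     (\<exists>p\<in>hyp5. finite ((\<lambda>M. poincare_ext M p) ` G)) \<or> (\<exists>z. finite ((\<lambda>M. moebius M z) ` G))"

end

(*
Conjugate A to D = diag(r, 1/r), put beta = (r - 1/r)^2 = delta_A^2 - 4, and let S be the conjugate of
B. Since C = [D, S] is conjugate to a real diagonal matrix of determinant 1, C + C^-1 is the real
scalar delta_C; its diagonal entries show that the two products of opposite off-diagonal entries
of S and S^-1 are equal to one real number xi, with delta_C = 2 + beta xi. As in the proof of
Jorgensen's inequality, S -> S D S^-1 turns xi into -beta xi (1 - xi), so if beta (1 + |xi|) < 1 the
iterates have xi -> 0. Their diagonal entries are real and tend to r and 1/r, and conjugation by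
a power of D balances the off-diagonal entries, whose product tends to 0; discreteness then makes
some iterate diagonal. Going back along the iteration, S itself is diagonal or antidiagonal, so
that the group permutes two boundary points and is elementary.
*)
theory Submission
  imports Defs
begin

section \<open>Quaternion conjugation, norm and real part\<close>

lemma qcnj_mult: "qcnj (p * q) = qcnj q * qcnj p"
  by (simp add: qcnj_def times_quat_def)

lemma qcnj_qcnj [simp]: "qcnj (qcnj p) = p"
  by (simp add: qcnj_def)

lemma qcnj_zero [simp]: "qcnj 0 = 0"
  by (simp add: qcnj_def zero_quat_def)

lemma of_real_quat: "of_real x = Quat x 0 0 0"
  by (simp add: of_real_def scaleR_quat_def one_quat_def)

lemma norm_quat_sq: "(norm p)\<^sup>2 = (qRe p)\<^sup>2 + (qI p)\<^sup>2 + (qJ p)\<^sup>2 + (qK p)\<^sup>2"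
  by (simp add: norm_quat_def)

lemma norm_qcnj [simp]: "norm (qcnj p) = norm p"
  by (simp add: norm_quat_def qcnj_def)

lemma mult_qcnj: "p * qcnj p = of_real ((norm p)\<^sup>2)"
  unfolding norm_quat_sq
  by (simp add: of_real_quat quat_eq_iff times_quat_def qcnj_def power2_eq_square)

lemma qcnj_mult_self: "qcnj p * p = of_real ((norm p)\<^sup>2)"
  unfolding norm_quat_sq
  by (simp add: of_real_quat quat_eq_iff times_quat_def qcnj_def power2_eq_square)

lemma qcnj_diff: "qcnj (p - q) = qcnj p - qcnj q"
  by (simp add: qcnj_def minus_quat_def)

lemma qcnj_scaleR: "qcnj (x *\<^sub>R p) = x *\<^sub>R qcnj p"
  by (simp add: qcnj_def scaleR_quat_def)

lemma add_qcnj: "p + qcnj p = of_real (2 * qRe p)"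
  by (simp add: qcnj_def plus_quat_def of_real_quat)

lemma qRe_qcnj [simp]: "qRe (qcnj p) = qRe p"
  by (simp add: qcnj_def)

lemma qRe_mult_commute: "qRe (p * q) = qRe (q * p)"
  by (simp add: times_quat_def mult.commute)

lemma qRe_simps [simp]:
  "qRe (p + q) = qRe p + qRe q" "qRe (x *\<^sub>R p) = x * qRe p" "qRe (of_real x) = x" "qRe 0 = 0"
  by (simp_all add: plus_quat_def scaleR_quat_def of_real_quat zero_quat_def)

lemma inner_quat_eq: "inner p q = qRe (p * qcnj q)"
  by (simp add: inner_quat_def times_quat_def qcnj_def)

lemma mult_of_real_quat: "p * of_real x = x *\<^sub>R p" for p :: quat
  by (simp add: of_real_def)

lemma of_real_mult_quat: "of_real x * p = x *\<^sub>R p" for p :: quat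
  by (simp add: of_real_def)

section \<open>Two by two matrices entry by entry\<close>

lemma mat2_eq_iff:
  "M = N \<longleftrightarrow> M$1$1 = N$1$1 \<and> M$1$2 = N$1$2 \<and> M$2$1 = N$2$1 \<and> M$2$2 = N$2$2"
  for M N :: "'a^2^2"
  by (auto simp: vec_eq_iff forall_2)

lemma mat2_mult: "(M ** N)$i$j = M$i$1 * N$1$j + M$i$2 * N$2$j" for M N :: "'a::semiring_1^2^2"
  by (simp add: matrix_matrix_mult_def sum_2)

lemma mat2_add_mult: "(L + M) ** N = L ** N + M ** N" for L M N :: "'a::semiring_1^2^2"
  by (simp add: mat2_eq_iff mat2_mult distrib_right algebra_simps)

lemma mat2_one [simp]: "(mat 1 :: 'a::semiring_1^2^2)$1$1 = 1" "(mat 1 :: 'a::semiring_1^2^2)$1$2 = 0"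
  "(mat 1 :: 'a::semiring_1^2^2)$2$1 = 0" "(mat 1 :: 'a::semiring_1^2^2)$2$2 = 1"
  by (simp_all add: mat_def)

lemma qdiag_nth [simp]:
  "qdiag p q $1$1 = p" "qdiag p q $1$2 = 0" "qdiag p q $2$1 = 0" "qdiag p q $2$2 = q"
  by (simp_all add: qdiag_def)

section \<open>Inverses of matrices of determinant 1\<close>

definition adj_entry :: "quat \<Rightarrow> quat \<Rightarrow> quat \<Rightarrow> quat \<Rightarrow> quat" where
  "adj_entry p q u v = (norm q)\<^sup>2 *\<^sub>R qcnj p - qcnj u * q * qcnj v"

text \<open>For commuting entries this is the classical adjugate times the conjugate of
  \<open>a * d - b * c\<close>, hence the inverse when that number has norm 1. Over the quaternions
  the factor cannot be pulled out, so it is absorbed into each entry.\<close>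

definition adj :: "quat^2^2 \<Rightarrow> quat^2^2" where
  "adj M = (let a = M$1$1; b = M$1$2; c = M$2$1; d = M$2$2 in
     vector [vector [adj_entry a d c b, adj_entry c b a d],
             vector [adj_entry b c d a, adj_entry d a b c]])"

lemma qRe_rotate: "qRe (a * b * c * d) = qRe (d * a * b * c)"
  by (metis mult.assoc qRe_mult_commute)

lemma qRe_reverse: "qRe (a * qcnj b * c * qcnj d) = qRe (d * qcnj c * b * qcnj a)"
  by (metis mult.assoc qRe_qcnj qcnj_mult qcnj_qcnj)

text \<open>Law of cosines for the two terms of \<open>adj_entry\<close>: every contribution carries
  a factor \<open>(norm q)\<^sup>2\<close>, and the remaining bracket is a squared determinant. For
  determinant 1 the entry thus has the norm of \<open>q\<close>.\<close>

lemma norm_adj_entry: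
  "(norm (adj_entry p q u v))\<^sup>2 =
     (norm q)\<^sup>2 * ((norm p)\<^sup>2 * (norm q)\<^sup>2 + (norm v)\<^sup>2 * (norm u)\<^sup>2 - 2 * qRe (p * qcnj u * q * qcnj v))"
proof -
  let ?x = "(norm q)\<^sup>2 *\<^sub>R qcnj p" and ?y = "qcnj u * q * qcnj v"
  have x: "norm ?x = (norm q)\<^sup>2 * norm p" and y: "norm ?y = norm u * norm q * norm v"
    by (simp_all add: norm_mult)
  have i: "inner ?x ?y = (norm q)\<^sup>2 * qRe (p * qcnj u * q * qcnj v)"
    by (simp add: inner_quat_eq qcnj_mult)
      (metis mult.assoc qRe_qcnj qcnj_mult qcnj_qcnj qRe_mult_commute)
  have "(norm (?x - ?y))\<^sup>2 = (norm ?x)\<^sup>2 + (norm ?y)\<^sup>2 - 2 * inner ?x ?y"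
    using dot_norm_neg[of ?x ?y] by simp
  then show ?thesis
    unfolding adj_entry_def i x y by algebra
qed

lemma adj_nth [simp]:
  "adj M $1$1 = adj_entry (M$1$1) (M$2$2) (M$2$1) (M$1$2)"
  "adj M $1$2 = adj_entry (M$2$1) (M$1$2) (M$1$1) (M$2$2)"
  "adj M $2$1 = adj_entry (M$1$2) (M$2$1) (M$2$2) (M$1$1)"
  "adj M $2$2 = adj_entry (M$2$2) (M$1$1) (M$1$2) (M$2$1)"
  by (simp_all add: adj_def Let_def)

lemma SL2H_simps [simp]:
  "carrier SL2H = {M. qdet M = 1}" "M \<otimes>\<^bsub>SL2H\<^esub> N = M ** N" "\<one>\<^bsub>SL2H\<^esub> = mat 1"
  by (simp_all add: SL2H_def)

lemma qdet_eq_1_iff: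
  "qdet M = 1 \<longleftrightarrow> (norm (M$1$1))\<^sup>2 * (norm (M$2$2))\<^sup>2 + (norm (M$1$2))\<^sup>2 * (norm (M$2$1))\<^sup>2
     - 2 * qRe (M$1$1 * qcnj (M$2$1) * M$2$2 * qcnj (M$1$2)) = 1"
  by (simp add: qdet_def Let_def)

context
  fixes a b c d :: quat
  assumes det: "(norm a)\<^sup>2 * (norm d)\<^sup>2 + (norm b)\<^sup>2 * (norm c)\<^sup>2 - 2 * qRe (a * qcnj c * d * qcnj b) = 1"
begin

text \<open>Swapping the rows, the columns or both only rotates or reverses the product inside
  \<open>qRe\<close>. Each identity below, proved for one position in the matrix, therefore holds
  for the others.\<close>

lemma det_rotations:
  "(norm a)\<^sup>2 * (norm d)\<^sup>2 + (norm b)\<^sup>2 * (norm c)\<^sup>2 - 2 * qRe (a * qcnj c * d * qcnj b) = 1"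
  "(norm c)\<^sup>2 * (norm b)\<^sup>2 + (norm d)\<^sup>2 * (norm a)\<^sup>2 - 2 * qRe (c * qcnj a * b * qcnj d) = 1"
  "(norm b)\<^sup>2 * (norm c)\<^sup>2 + (norm a)\<^sup>2 * (norm d)\<^sup>2 - 2 * qRe (b * qcnj d * c * qcnj a) = 1"
  "(norm d)\<^sup>2 * (norm a)\<^sup>2 + (norm c)\<^sup>2 * (norm b)\<^sup>2 - 2 * qRe (d * qcnj b * a * qcnj c) = 1"
proof -
  have "qRe (c * qcnj a * b * qcnj d) = qRe (a * qcnj c * d * qcnj b)"
    by (metis qRe_reverse qRe_rotate)
  moreover have "qRe (b * qcnj d * c * qcnj a) = qRe (a * qcnj c * d * qcnj b)"
    by (metis qRe_reverse)
  moreover have "qRe (d * qcnj b * a * qcnj c) = qRe (a * qcnj c * d * qcnj b)"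
    by (metis qRe_rotate)
  ultimately show
    "(norm a)\<^sup>2 * (norm d)\<^sup>2 + (norm b)\<^sup>2 * (norm c)\<^sup>2 - 2 * qRe (a * qcnj c * d * qcnj b) = 1"
    "(norm c)\<^sup>2 * (norm b)\<^sup>2 + (norm d)\<^sup>2 * (norm a)\<^sup>2 - 2 * qRe (c * qcnj a * b * qcnj d) = 1"
    "(norm b)\<^sup>2 * (norm c)\<^sup>2 + (norm a)\<^sup>2 * (norm d)\<^sup>2 - 2 * qRe (b * qcnj d * c * qcnj a) = 1"
    "(norm d)\<^sup>2 * (norm a)\<^sup>2 + (norm c)\<^sup>2 * (norm b)\<^sup>2 - 2 * qRe (d * qcnj b * a * qcnj c) = 1"
    using det by (simp_all add: mult.commute)
qed

lemma mult_adj_entry_diag: "a * adj_entry a d c b + b * adj_entry b c d a = 1"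
proof -
  have "a * adj_entry a d c b + b * adj_entry b c d a
      = (norm d)\<^sup>2 *\<^sub>R (a * qcnj a) + (norm c)\<^sup>2 *\<^sub>R (b * qcnj b)
        - (a * qcnj c * d * qcnj b + qcnj (a * qcnj c * d * qcnj b))"
    by (simp add: adj_entry_def qcnj_mult algebra_simps mult.assoc)
  also have "\<dots> = of_real ((norm a)\<^sup>2 * (norm d)\<^sup>2 + (norm b)\<^sup>2 * (norm c)\<^sup>2
      - 2 * qRe (a * qcnj c * d * qcnj b))"
    unfolding mult_qcnj add_qcnj of_real_def by (simp add: algebra_simps)
  finally show ?thesis using det by simp
qed

lemma adj_entry_mult_diag: "adj_entry a d c b * a + adj_entry c b a d * c = 1"
proof -
  have "adj_entry a d c b * a + adj_entry c b a d * c
      = (norm d)\<^sup>2 *\<^sub>R (qcnj a * a) + (norm b)\<^sup>2 *\<^sub>R (qcnj c * c)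
        - (qcnj c * d * qcnj b * a + qcnj (qcnj c * d * qcnj b * a))"
    by (simp add: adj_entry_def qcnj_mult algebra_simps mult.assoc)
  also have "\<dots> = of_real ((norm a)\<^sup>2 * (norm d)\<^sup>2 + (norm b)\<^sup>2 * (norm c)\<^sup>2
      - 2 * qRe (qcnj c * d * qcnj b * a))"
    unfolding qcnj_mult_self add_qcnj of_real_def by (simp add: algebra_simps)
  finally show ?thesis using det by (simp add: qRe_rotate[of "qcnj c"] del: qRe_simps)
qed

lemma mult_adj_entry_off: "a * adj_entry c b a d + b * adj_entry d a b c = 0"
proof -
  have "a * adj_entry c b a d + b * adj_entry d a b c
      = (norm b)\<^sup>2 *\<^sub>R (a * qcnj c) - (a * qcnj a) * (b * qcnj d)
        + ((norm a)\<^sup>2 *\<^sub>R (b * qcnj d) - (b * qcnj b) * (a * qcnj c))"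
    by (simp add: adj_entry_def algebra_simps mult.assoc)
  then show ?thesis
    unfolding mult_qcnj by (simp add: of_real_mult_quat del: of_real_power)
qed

lemma adj_entry_mult_off: "adj_entry a d c b * b + adj_entry c b a d * d = 0"
proof -
  have "adj_entry a d c b * b + adj_entry c b a d * d
      = (norm d)\<^sup>2 *\<^sub>R (qcnj a * b) - qcnj c * d * (qcnj b * b)
        + ((norm b)\<^sup>2 *\<^sub>R (qcnj c * d) - qcnj a * b * (qcnj d * d))"
    by (simp add: adj_entry_def algebra_simps mult.assoc)
  then show ?thesis
    unfolding qcnj_mult_self by (simp add: mult_of_real_quat del: of_real_power)
qed

lemma norm_adj_entry_eq: "norm (adj_entry a d c b) = norm d"
proof -
  have "(norm (adj_entry a d c b))\<^sup>2 = (norm d)\<^sup>2"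
    unfolding norm_adj_entry det_rotations(1) by simp
  then show ?thesis by simp
qed

text \<open>Used for the determinant of the inverse. Every term of the expansion has the left factor
  \<open>qcnj c * d\<close>, and the determinant equation makes the cofactor equal to -1.\<close>

lemma adj_entry_mult_qcnj: "adj_entry a d c b * qcnj (adj_entry b c d a) = - (qcnj c * d)"
proof -
  have "adj_entry a d c b * qcnj (adj_entry b c d a)
      = (norm d)\<^sup>2 *\<^sub>R (norm c)\<^sup>2 *\<^sub>R (qcnj a * b) - (norm d)\<^sup>2 *\<^sub>R (qcnj a * a) * (qcnj c * d)
        - (norm c)\<^sup>2 *\<^sub>R (qcnj c * d * (qcnj b * b)) + qcnj c * d * (qcnj b * a * qcnj c * d)"
    by (simp add: adj_entry_def qcnj_diff qcnj_scaleR qcnj_mult algebra_simps mult.assoc)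
  \<comment> \<open>The squared norms are split as \<open>d * qcnj d\<close> and
    \<open>qcnj c * c\<close> so that \<open>qcnj c * d\<close> appears on the left.\<close>
  also have "(norm d)\<^sup>2 *\<^sub>R (norm c)\<^sup>2 *\<^sub>R (qcnj a * b) = qcnj c * d * (qcnj d * c * qcnj a * b)"
  proof -
    have "qcnj c * d * (qcnj d * c * qcnj a * b) = qcnj c * (d * qcnj d) * c * qcnj a * b"
      by (simp add: mult.assoc)
    also have "\<dots> = (norm d)\<^sup>2 *\<^sub>R ((qcnj c * c) * (qcnj a * b))"
      unfolding mult_qcnj by (simp add: mult_of_real_quat mult.assoc del: of_real_power)
    finally show ?thesis
      unfolding qcnj_mult_self by (simp add: of_real_mult_quat del: of_real_power)
  qed
  also have "qcnj c * d * (qcnj d * c * qcnj a * b) - (norm d)\<^sup>2 *\<^sub>R (qcnj a * a) * (qcnj c * d)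
        - (norm c)\<^sup>2 *\<^sub>R (qcnj c * d * (qcnj b * b)) + qcnj c * d * (qcnj b * a * qcnj c * d)
      = qcnj c * d * ((qcnj b * a * qcnj c * d + qcnj (qcnj b * a * qcnj c * d))
          - of_real ((norm a)\<^sup>2 * (norm d)\<^sup>2 + (norm b)\<^sup>2 * (norm c)\<^sup>2))"
    unfolding qcnj_mult_self
    by (simp add: qcnj_mult of_real_mult_quat mult_of_real_quat algebra_simps mult.assoc
        del: of_real_power of_real_mult of_real_add)
  also have "\<dots> = - (qcnj c * d)"
  proof -
    have "qRe (qcnj b * a * qcnj c * d) = qRe (a * qcnj c * d * qcnj b)"
      by (metis mult.assoc qRe_mult_commute)
    then have "of_real (2 * qRe (qcnj b * a * qcnj c * d))
        - of_real ((norm a)\<^sup>2 * (norm d)\<^sup>2 + (norm b)\<^sup>2 * (norm c)\<^sup>2) = (- 1 :: quat)"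
      using det by (metis minus_diff_eq of_real_1 of_real_diff of_real_minus)
    then show ?thesis unfolding add_qcnj by simp
  qed
  finally show ?thesis .
qed

end

lemma adj_inverse:
  assumes "qdet M = 1"
  shows "M ** adj M = mat 1" "adj M ** M = mat 1" "qdet (adj M) = 1"
proof -
  note det = assms[unfolded qdet_eq_1_iff]
  note r = det_rotations[OF det]
  show "M ** adj M = mat 1"
    using mult_adj_entry_diag[OF r(1)] mult_adj_entry_diag[OF r(4)]
      mult_adj_entry_off[OF r(1)] mult_adj_entry_off[OF r(4)]
    by (simp add: mat2_eq_iff mat2_mult add.commute)
  show "adj M ** M = mat 1"
    using adj_entry_mult_diag[OF r(1)] adj_entry_mult_diag[OF r(4)]
      adj_entry_mult_off[OF r(1)] adj_entry_mult_off[OF r(4)]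
    by (simp add: mat2_eq_iff mat2_mult add.commute)
  have n: "norm (adj M $1$1) = norm (M$2$2)" "norm (adj M $1$2) = norm (M$1$2)"
    "norm (adj M $2$1) = norm (M$2$1)" "norm (adj M $2$2) = norm (M$1$1)"
    using r[THEN norm_adj_entry_eq] by simp_all
  \<comment> \<open>The identity is applied to both columns of \<open>adj M\<close>; the two minus
    signs cancel, and a cyclic rotation recovers the product in the determinant of
    \<open>M\<close>.\<close>
  have p: "adj M $1$1 * qcnj (adj M $2$1) * adj M $2$2 * qcnj (adj M $1$2)
      = qcnj (M$2$1) * M$2$2 * (qcnj (M$1$2) * M$1$1)"
    using adj_entry_mult_qcnj[OF r(1)] adj_entry_mult_qcnj[OF r(4)]
    by (simp add: mult.assoc)
  have "qRe (qcnj (M$2$1) * M$2$2 * (qcnj (M$1$2) * M$1$1))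
      = qRe (M$1$1 * qcnj (M$2$1) * M$2$2 * qcnj (M$1$2))"
    using qRe_rotate[of "qcnj (M$2$1)" "M$2$2" "qcnj (M$1$2)" "M$1$1"] by (simp only: mult.assoc)
  then show "qdet (adj M) = 1"
    using det unfolding qdet_eq_1_iff n p by (simp only: mult.commute[of "(norm (M$2$2))\<^sup>2"])
qed

text \<open>The group inverse is a definite description over the carrier, so \<open>N\<close> must
  also have determinant 1. Right inverses of \<open>M\<close> being unique, \<open>N\<close> is
  \<open>adj M\<close>, whose determinant is known.\<close>

lemma inv_SL2H_eqI:
  assumes "qdet M = 1" "M ** N = mat 1" "N ** M = mat 1"
  shows "inv\<^bsub>SL2H\<^esub> M = N"
proof -
  have u: "X = N" if "M ** X = mat 1" for X
    by (metis assms(3) matrix_mul_assoc matrix_mul_lid matrix_mul_rid that)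
  then have "qdet N = 1"
    using adj_inverse[OF assms(1)] by metis
  then show ?thesis
    unfolding m_inv_def SL2H_simps using assms(2,3) by (intro the_equality) (simp, blast intro: u)
qed

lemma inv_SL2H:
  assumes "qdet M = 1"
  shows "M ** inv\<^bsub>SL2H\<^esub> M = mat 1" "inv\<^bsub>SL2H\<^esub> M ** M = mat 1" "qdet (inv\<^bsub>SL2H\<^esub> M) = 1"
  using adj_inverse[OF assms] inv_SL2H_eqI[OF assms] by metis+

section \<open>Conjugation, real trace and monomial matrices\<close>

lemma inverse_conj:
  assumes "P ** P' = mat 1" "P' ** P = mat 1" "X ** Y = mat 1"
  shows "(P ** X ** P') ** (P ** Y ** P') = (mat 1 :: 'a::semiring_1^'n^'n)"
  by (metis assms matrix_mul_assoc matrix_mul_rid)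

text \<open>The trace itself is not cyclic over the quaternions, but its real part is.\<close>

lemma delta_mult_commute: "delta (M ** N) = delta (N ** M)"
  by (simp add: delta_def mat2_mult qRe_mult_commute[of "M$_$_"])

lemma delta_conj: "P' ** P = mat 1 \<Longrightarrow> delta (P ** X ** P') = delta X"
  by (metis delta_mult_commute matrix_mul_assoc matrix_mul_lid)


text \<open>Among invertible matrices these are the ones that map the boundary pair {0, infinity} to
  itself.\<close>

definition monomial :: "quat^2^2 \<Rightarrow> bool" where
  "monomial X \<longleftrightarrow> X$1$2 = 0 \<and> X$2$1 = 0 \<or> X$1$1 = 0 \<and> X$2$2 = 0"

definition rdiag :: "real \<Rightarrow> quat^2^2" where
  "rdiag r = qdiag (of_real r) (of_real (1 / r))"

lemma rdiag_nth [simp]: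
  "rdiag r $1$1 = of_real r" "rdiag r $1$2 = 0" "rdiag r $2$1 = 0" "rdiag r $2$2 = of_real (1 / r)"
  by (simp_all add: rdiag_def)

lemma rdiag_inverse: "r \<noteq> 0 \<Longrightarrow> rdiag r ** rdiag (1 / r) = mat 1"
  by (simp add: mat2_eq_iff mat2_mult del: of_real_divide flip: of_real_mult)

section \<open>The quadratic step on off-diagonal products\<close>

text \<open>The real number \<open>\<xi>\<close> measures the commutator: if \<open>D = diag(r, 1 / r)\<close> and \<open>[D, S]\<close> is strictly
  hyperbolic, then \<open>delta [D, S] = 2 + (r - 1 / r)\<^sup>2 \<xi>\<close>. The step \<open>S \<mapsto> S D S\<^sup>-\<^sup>1\<close> acts on it as a
  quadratic map.\<close>

definition off_product :: "quat^2^2 \<Rightarrow> quat^2^2 \<Rightarrow> real \<Rightarrow> bool" where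
  "off_product S S' \<xi> \<longleftrightarrow> S ** S' = mat 1 \<and> S' ** S = mat 1 \<and>
     S$1$2 * S'$2$1 = of_real \<xi> \<and> S$2$1 * S'$1$2 = of_real \<xi>"

text \<open>A real product is central, so \<open>p * (q * p) = p * of_real x\<close>, and a nonzero
  \<open>p\<close> can be cancelled.\<close>

lemma mult_real_swap:
  fixes p q :: quat
  assumes "p * q = of_real x"
  shows "q * p = of_real x"
proof (cases "p = 0")
  case True
  then show ?thesis using assms by simp
next
  case False
  have "p * (q * p) = p * of_real x"
    by (metis assms mult.assoc mult_of_real_quat of_real_mult_quat)
  with False show ?thesis by simp
qed

lemma off_productD:
  assumes "off_product S S' \<xi>"
  shows "S$1$1 * S'$1$1 = of_real (1 - \<xi>)" "S$2$2 * S'$2$2 = of_real (1 - \<xi>)"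
    "S'$1$1 * S$1$1 = of_real (1 - \<xi>)" "S'$2$2 * S$2$2 = of_real (1 - \<xi>)"
    "S$1$2 * S'$2$1 = of_real \<xi>" "S$2$1 * S'$1$2 = of_real \<xi>"
    "S'$1$2 * S$2$1 = of_real \<xi>" "S'$2$1 * S$1$2 = of_real \<xi>"
    "S$1$2 * S'$2$2 = - (S$1$1 * S'$1$2)" "S$2$2 * S'$2$1 = - (S$2$1 * S'$1$1)"
    "S'$1$2 * S$2$2 = - (S'$1$1 * S$1$2)"
    "S ** S' = mat 1" "S' ** S = mat 1"
proof -
  show o: "S$1$2 * S'$2$1 = of_real \<xi>" "S$2$1 * S'$1$2 = of_real \<xi>" 
    and i: "S ** S' = mat 1" "S' ** S = mat 1"
    using assms by (auto simp: off_product_def)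
  show "S'$1$2 * S$2$1 = of_real \<xi>" "S'$2$1 * S$1$2 = of_real \<xi>"
    using o by (auto intro: mult_real_swap)
  show d: "S$1$1 * S'$1$1 = of_real (1 - \<xi>)" "S$2$2 * S'$2$2 = of_real (1 - \<xi>)"
    using i(1) o by (simp_all add: mat2_eq_iff mat2_mult algebra_simps)
  show "S'$1$1 * S$1$1 = of_real (1 - \<xi>)" "S'$2$2 * S$2$2 = of_real (1 - \<xi>)"
    by (rule mult_real_swap[OF d(1)], rule mult_real_swap[OF d(2)])
  show "S$1$2 * S'$2$2 = - (S$1$1 * S'$1$2)" "S$2$2 * S'$2$1 = - (S$2$1 * S'$1$1)"
    "S'$1$2 * S$2$2 = - (S'$1$1 * S$1$2)"
    using i by (simp_all add: mat2_eq_iff mat2_mult eq_neg_iff_add_eq_0 add.commute)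
qed

text \<open>The diagonal is real because the products of opposite entries of \<open>S\<close> and
  \<open>S'\<close> are. Off the diagonal, the zeros of \<open>S ** S'\<close> merge the two terms
  into one with factor \<open>r - 1 / r\<close>.\<close>

lemma conj_rdiag_nth:
  assumes "off_product S S' \<xi>"
  shows "(S ** rdiag r ** S')$1$1 = of_real (r * (1 - \<xi>) + \<xi> / r)"
    "(S ** rdiag r ** S')$1$2 = (r - 1 / r) *\<^sub>R (S$1$1 * S'$1$2)"
    "(S ** rdiag r ** S')$2$1 = (r - 1 / r) *\<^sub>R (S$2$1 * S'$1$1)"
    "(S ** rdiag r ** S')$2$2 = of_real (r * \<xi> + (1 - \<xi>) / r)"
proof -
  note o = off_productD[OF assms]
  have e: "(S ** rdiag r ** S')$i$j = r *\<^sub>R (S$i$1 * S'$1$j) + (1 / r) *\<^sub>R (S$i$2 * S'$2$j)" for i j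
    by (simp add: mat2_mult mult_of_real_quat del: of_real_divide)
  show "(S ** rdiag r ** S')$1$1 = of_real (r * (1 - \<xi>) + \<xi> / r)"
    "(S ** rdiag r ** S')$2$2 = of_real (r * \<xi> + (1 - \<xi>) / r)"
    unfolding e o(1,2,5,6) of_real_def by (simp_all add: scaleR_add_left)
  show "(S ** rdiag r ** S')$1$2 = (r - 1 / r) *\<^sub>R (S$1$1 * S'$1$2)"
    "(S ** rdiag r ** S')$2$1 = (r - 1 / r) *\<^sub>R (S$2$1 * S'$1$1)"
    unfolding e o(9,10) by (simp_all add: scaleR_diff_left)
qed

text \<open>In \<open>S$1$1 * S'$1$2 * (S$2$1 * S'$1$1)\<close> the inner pair is the real number
  \<xi> and can be pulled out, leaving \<open>\<xi> * (1 - \<xi>)\<close>. The sign comes from the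
  inverse, where \<open>1 / r - r\<close> replaces \<open>r - 1 / r\<close>.\<close>

lemma off_product_step:
  assumes "off_product S S' \<xi>" "r \<noteq> 0"
  shows "off_product (S ** rdiag r ** S') (S ** rdiag (1 / r) ** S') (- ((r - 1 / r)\<^sup>2 * \<xi> * (1 - \<xi>)))"
proof -
  note o = off_productD[OF assms(1)]
  have inv: "(S ** rdiag r ** S') ** (S ** rdiag (1 / r) ** S') = mat 1"
    "(S ** rdiag (1 / r) ** S') ** (S ** rdiag r ** S') = mat 1"
    using inverse_conj[OF o(12,13)] rdiag_inverse[of r] rdiag_inverse[of "1/r"] assms(2) by auto
  have "S$1$1 * S'$1$2 * (S$2$1 * S'$1$1) = S$1$1 * (S'$1$2 * S$2$1) * S'$1$1"
    by (simp add: mult.assoc)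
  also have "\<dots> = \<xi> *\<^sub>R (S$1$1 * S'$1$1)"
    unfolding o(7) by (simp add: mult_of_real_quat)
  finally have 1: "S$1$1 * S'$1$2 * (S$2$1 * S'$1$1) = of_real (\<xi> * (1 - \<xi>))"
    unfolding o by (simp add: of_real_def)
  have "S$2$1 * S'$1$1 * (S$1$1 * S'$1$2) = S$2$1 * (S'$1$1 * S$1$1) * S'$1$2"
    by (simp add: mult.assoc)
  also have "\<dots> = (1 - \<xi>) *\<^sub>R (S$2$1 * S'$1$2)"
    unfolding o(3) by (simp add: mult_of_real_quat del: of_real_diff)
  finally have 2: "S$2$1 * S'$1$1 * (S$1$1 * S'$1$2) = of_real (\<xi> * (1 - \<xi>))"
    unfolding o by (simp add: of_real_def mult.commute)
  have s: "(1 / r - r) * ((r - 1 / r) * x) = - ((r - 1 / r)\<^sup>2 * x)" for x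
    by (simp add: power2_eq_square algebra_simps)
  show ?thesis
    unfolding off_product_def conj_rdiag_nth[OF assms(1)] using inv
    by (simp add: 1 2 s of_real_def mult.assoc[of "(r - 1 / r)\<^sup>2"])
qed

text \<open>This carries the conclusion back along the iteration. The conjugate cannot be
  antidiagonal, so its off-diagonal entries vanish; this leaves \<xi> = 1 with \<open>S\<close>
  antidiagonal, or \<xi> = 0 with \<open>S\<close> diagonal.\<close>

lemma monomial_conj_rdiagD:
  assumes "off_product S S' \<xi>" "r \<notin> {0, 1, -1}" "monomial (S ** rdiag r ** S')"
  shows "monomial S"
proof -
  note o = off_productD[OF assms(1)]
  have rr: "r - 1 / r \<noteq> 0" "r + 1 / r \<noteq> 0"
  proof -
    have "r * (r - 1 / r) = (r - 1) * (r + 1)" "r * (r + 1 / r) = r\<^sup>2 + 1"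
      using assms(2) by (simp_all add: field_simps power2_eq_square)
    moreover have "r\<^sup>2 + 1 \<noteq> 0" by (smt (verit) zero_le_power2)
    ultimately show "r - 1 / r \<noteq> 0" "r + 1 / r \<noteq> 0"
      using assms(2) by auto
  qed
  \<comment> \<open>The two diagonal entries add up to \<open>r + 1 / r\<close>, so they cannot both
    vanish.\<close>
  have "\<not> (r * (1 - \<xi>) + \<xi> / r = 0 \<and> r * \<xi> + (1 - \<xi>) / r = 0)"
  proof
    assume "r * (1 - \<xi>) + \<xi> / r = 0 \<and> r * \<xi> + (1 - \<xi>) / r = 0"
    moreover have "r + 1 / r = (r * (1 - \<xi>) + \<xi> / r) + (r * \<xi> + (1 - \<xi>) / r)"
      by (simp add: algebra_simps diff_divide_distrib)
    ultimately show False using rr by simp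
  qed
  then have z: "S$1$1 = 0 \<or> S'$1$2 = 0" "S$2$1 = 0 \<or> S'$1$1 = 0"
    using assms(3) rr unfolding monomial_def conj_rdiag_nth[OF assms(1)] of_real_eq_0_iff by auto
  show ?thesis
  proof (cases "S$1$1 = 0")
    case True
    then have "\<xi> = 1" using o(1) by simp
    then have "S$2$1 \<noteq> 0" "S'$1$2 \<noteq> 0" using o(6) by auto
    then have "S$2$2 = 0" using z o(11) by auto
    with True show ?thesis by (simp add: monomial_def)
  next
    case False
    with z have b: "S'$1$2 = 0" by simp
    then have "\<xi> = 0" using o(6) by simp
    then have "S'$1$1 \<noteq> 0" using o(1) by auto
    then have "S$2$1 = 0" "S$1$2 = 0" using z o(11) b by auto
    then show ?thesis by (simp add: monomial_def)
  qed
qed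

section \<open>Balancing the off-diagonal entries\<close>

definition offscale :: "real \<Rightarrow> quat^2^2 \<Rightarrow> quat^2^2" where
  "offscale t X = vector [vector [X$1$1, t *\<^sub>R X$1$2], vector [(1 / t) *\<^sub>R X$2$1, X$2$2]]"

lemma offscale_nth [simp]:
  "offscale t X $1$1 = X$1$1" "offscale t X $1$2 = t *\<^sub>R X$1$2"
  "offscale t X $2$1 = (1 / t) *\<^sub>R X$2$1" "offscale t X $2$2 = X$2$2"
  by (simp_all add: offscale_def)

text \<open>Such a conjugation keeps the diagonal and the product of the two off-diagonal norms; it
  only shifts size from one off-diagonal entry to the other.\<close>

lemma rdiag_conj_eq_offscale: "r \<noteq> 0 \<Longrightarrow> rdiag r ** X ** rdiag (1 / r) = offscale (r\<^sup>2) X"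
  by (simp add: mat2_eq_iff mat2_mult of_real_mult_quat mult_of_real_quat power2_eq_square
      del: of_real_divide)

lemma offscale_offscale: "offscale s (offscale t X) = offscale (s * t) X"
  by (simp add: mat2_eq_iff)

lemma norm_mat2_le: "norm X \<le> norm (X$1$1) + norm (X$1$2) + norm (X$2$1) + norm (X$2$2)"
  for X :: "'a::real_normed_vector^2^2"
proof -
  have v: "norm Y \<le> norm (Y$1) + norm (Y$2)" for Y :: "'b::real_normed_vector^2"
    unfolding norm_vec_def using L2_set_le_sum[of UNIV "\<lambda>i. norm (Y$i)"] by (simp add: sum_2)
  show ?thesis using v[of X] v[of "X$1"] v[of "X$2"] by linarith
qed

text \<open>For positive \<open>x\<close>, bring the first quantity below \<open>e\<close> but not
  below \<open>e / m\<close>. The product of the two does not depend on \<open>k\<close>, so the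
  second is at most \<open>x * y * m / e\<close>.\<close>

lemma balance_gt1:
  fixes m :: real
  assumes "m > 1" "x \<ge> 0" "y \<ge> 0" "e > 0" "x * y * m < e\<^sup>2"
  shows "\<exists>k::int. x * m powi k < e \<and> y * m powi (- k) < e"
proof -
  \<comment> \<open>\<open>u\<close> stands in for \<open>x\<close>: it has to be positive for the
    logarithm below, also when \<open>x = 0\<close>, and the strict inequality leaves room for
    this.\<close>
  obtain u where u: "u \<ge> x" "u > 0" "u * y * m < e\<^sup>2"
  proof (cases "y = 0")
    case True
    then show thesis using that[of "x + 1"] assms by auto
  next
    case False
    with assms have p: "y * m > 0" by simp
    have "x < e\<^sup>2 / (y * m)" using assms p by (simp add: field_simps)
    then obtain u where "x < u" "u < e\<^sup>2 / (y * m)" using dense by blast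
    then show thesis using that[of u] assms p by (simp add: field_simps)
  qed
  \<comment> \<open>The largest integer with \<open>u * m powi k < e\<close>; ceiling minus 1,
    rather than floor, keeps the inequality strict when the logarithm is an integer.\<close>
  define k where "k = \<lceil>log m (e / u)\<rceil> - 1"
  have pw: "m powi j = m powr of_int j" for j
    using assms(1) by (simp add: powr_real_of_int')
  have "m powr of_int k < m powr log m (e / u)"
    using assms(1) by (intro powr_less_mono) (auto simp: k_def, linarith)
  then have a: "m powi k < e / u"
    using assms u by (simp add: pw)
  have "m powr log m (e / u) \<le> m powr of_int (k + 1)"
    using assms(1) by (intro powr_mono) (auto simp: k_def)
  then have b: "e / u \<le> m powi k * m"
    using assms u by (simp add: pw powr_add)
  have pos: "m powi k > 0" using assms(1) by simp
  have "x * m powi k \<le> u * m powi k" using u pos by simp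
  also have "\<dots> < e" using a u by (simp add: field_simps)
  finally have 1: "x * m powi k < e" .
  have "y * e \<le> y * (u * m * m powi k)"
    using b u assms(3) by (intro mult_left_mono) (auto simp: field_simps)
  also have "\<dots> = (u * y * m) * m powi k" by simp
  also have "\<dots> < e\<^sup>2 * m powi k" using u pos by simp
  finally have "y < e * m powi k" using assms(4) by (simp add: power2_eq_square)
  then have "y * m powi (- k) < e" using pos by (simp add: power_int_minus field_simps)
  with 1 show ?thesis by blast
qed

text \<open>For \<open>m < 1\<close> the roles of \<open>x\<close> and \<open>y\<close> are
  exchanged and \<open>1 / m\<close> takes the place of \<open>m\<close>; the weight
  \<open>m + 1 / m\<close> serves both cases.\<close>

lemma balance:
  fixes m :: real
  assumes "m > 0" "m \<noteq> 1" "x \<ge> 0" "y \<ge> 0" "e > 0" "x * y * (m + 1 / m) < e\<^sup>2"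
  shows "\<exists>k::int. x * m powi k < e \<and> y * m powi (- k) < e"
proof (cases "m > 1")
  case True
  have "x * y * m \<le> x * y * (m + 1 / m)" using assms by (intro mult_left_mono) auto
  then show ?thesis using balance_gt1[OF True assms(3-5)] assms(6) by simp
next
  case False
  with assms have m: "1 / m > 1" by simp
  have "y * x * (1 / m) \<le> x * y * (m + 1 / m)" using assms by (subst mult.commute[of y x], intro mult_left_mono) auto
  then obtain k :: int where "y * (1 / m) powi k < e \<and> x * (1 / m) powi (- k) < e"
    using balance_gt1[OF m assms(4,3,5)] assms(6) by auto
  then show ?thesis
    by (intro exI[of _ k]) (simp add: power_int_minus power_int_divide_distrib field_simps)
qed


section \<open>Isolation of \<open>rdiag r\<close> and the iteration\<close>

context
  fixes H :: "(quat^2^2) set" and r e :: real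
  assumes mult_closed: "\<And>X Y. X \<in> H \<Longrightarrow> Y \<in> H \<Longrightarrow> X ** Y \<in> H"
    and rdiag_mem: "rdiag r \<in> H" "rdiag (1 / r) \<in> H"
    and r: "r \<notin> {0, 1, -1}"
    and e: "e > 0"
    and isolated: "\<And>X. X \<in> H \<Longrightarrow> dist X (rdiag r) < e \<Longrightarrow> X = rdiag r"
begin

lemma offscale_mem:
  assumes "X \<in> H"
  shows "offscale ((r\<^sup>2) powi k) X \<in> H"
proof -
  have up: "offscale ((r\<^sup>2) ^ n) X \<in> H" for n
  proof (induction n)
    case 0
    have "offscale 1 X = X" by (simp add: mat2_eq_iff)
    then show ?case using assms by simp
  next
    case (Suc n)
    then have "rdiag r ** offscale ((r\<^sup>2) ^ n) X ** rdiag (1 / r) \<in> H"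
      using mult_closed rdiag_mem by blast
    then show ?case using r by (simp add: rdiag_conj_eq_offscale offscale_offscale)
  qed
  have down: "offscale (((1 / r)\<^sup>2) ^ n) X \<in> H" for n
  proof (induction n)
    case 0
    have "offscale 1 X = X" by (simp add: mat2_eq_iff)
    then show ?case using assms by simp
  next
    case (Suc n)
    then have "rdiag (1 / r) ** offscale (((1 / r)\<^sup>2) ^ n) X ** rdiag (1 / (1 / r)) \<in> H"
      using mult_closed rdiag_mem by simp
    then show ?case
      by (subst (asm) rdiag_conj_eq_offscale) (use r in \<open>simp_all add: offscale_offscale\<close>)
  qed
  show ?thesis
    using up[of "nat k"] down[of "nat (- k)"]
    by (cases "k \<ge> 0") (auto simp: power_int_def power_divide power_one_over divide_inverse power_inverse)
qed

text \<open>The diagonal of the conjugate differs from that of \<open>rdiag r\<close> by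
  \<open>\<xi> * (r - 1 / r)\<close> up to sign, and its off-diagonal norms have product at most
  \<open>\<bar>\<xi>\<bar>\<close>. Balancing them brings all four entries within
  \<open>e / 4\<close> of \<open>rdiag r\<close>. By isolation the balanced matrix is
  \<open>rdiag r\<close>, so the off-diagonal entries were already zero.\<close>

lemma monomial_conj_rdiag_if_small:
  assumes S: "off_product S S' \<xi>" "S \<in> H" "S' \<in> H"
    and le: "(r - 1 / r)\<^sup>2 * (1 + \<bar>\<xi>\<bar>) \<le> 1"
    and d: "\<bar>\<xi>\<bar> * \<bar>r - 1 / r\<bar> < e / 4"
    and o: "\<bar>\<xi>\<bar> * (r\<^sup>2 + 1 / r\<^sup>2) < (e / 4)\<^sup>2"
  shows "monomial (S ** rdiag r ** S')"
proof -
  define X where "X = S ** rdiag r ** S'"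
  note n = conj_rdiag_nth[OF S(1), of r, folded X_def]
  have XH: "X \<in> H" unfolding X_def using S rdiag_mem mult_closed by blast
  have m: "r\<^sup>2 > 0" "r\<^sup>2 \<noteq> 1" using r by (auto simp: power2_eq_1_iff)
  \<comment> \<open>Norms multiply, so the four factors may be regrouped into the two real products
    controlled by \<xi>.\<close>
  have "norm (X$1$2) * norm (X$2$1)
      = (r - 1 / r)\<^sup>2 * (norm (S$1$1 * S'$1$1) * norm (S$2$1 * S'$1$2))"
    unfolding n by (simp add: norm_mult power2_eq_square flip: abs_mult)
  also have "\<dots> = (r - 1 / r)\<^sup>2 * (\<bar>1 - \<xi>\<bar> * \<bar>\<xi>\<bar>)"
    unfolding off_productD(1,6)[OF S(1)] norm_of_real by simp
  also have "\<dots> \<le> (r - 1 / r)\<^sup>2 * ((1 + \<bar>\<xi>\<bar>) * \<bar>\<xi>\<bar>)"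
    by (intro mult_left_mono mult_right_mono) auto
  also have "\<dots> \<le> \<bar>\<xi>\<bar>"
    using mult_right_mono[OF le, of "\<bar>\<xi>\<bar>"] by (simp add: mult.assoc)
  finally have p: "norm (X$1$2) * norm (X$2$1) * (r\<^sup>2 + 1 / r\<^sup>2) \<le> \<bar>\<xi>\<bar> * (r\<^sup>2 + 1 / r\<^sup>2)"
    by (intro mult_right_mono) auto
  obtain k :: int where k: "norm (X$1$2) * (r\<^sup>2) powi k < e / 4"
    "norm (X$2$1) * (r\<^sup>2) powi (- k) < e / 4"
    using balance[OF m, of "norm (X$1$2)" "norm (X$2$1)" "e / 4"] p o e by auto
  define t where "t = (r\<^sup>2) powi k"
  have t: "t > 0" using m by (simp add: t_def)
  have k': "norm (X$1$2) * t < e / 4" "norm (X$2$1) / t < e / 4"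
    using k by (simp_all only: t_def power_int_minus divide_inverse)
  have d1: "norm (X$1$1 - of_real r) < e / 4"
  proof -
    have "X$1$1 - of_real r = of_real (- (\<xi> * (r - 1 / r)))"
      unfolding n of_real_diff[symmetric] by (simp add: algebra_simps)
    then show ?thesis using d by (simp only: norm_of_real abs_minus_cancel abs_mult)
  qed
  have d2: "norm (X$2$2 - of_real (1 / r)) < e / 4"
  proof -
    have "X$2$2 - of_real (1 / r) = of_real (\<xi> * (r - 1 / r))"
      unfolding n of_real_diff[symmetric] by (simp add: algebra_simps diff_divide_distrib)
    then show ?thesis using d by (simp only: norm_of_real abs_minus_cancel abs_mult)
  qed
  have "dist (offscale t X) (rdiag r)
      \<le> norm (X$1$1 - of_real r) + norm (t *\<^sub>R X$1$2) + norm ((1 / t) *\<^sub>R X$2$1)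
        + norm (X$2$2 - of_real (1 / r))"
    unfolding dist_norm using norm_mat2_le[of "offscale t X - rdiag r"]
    by (simp del: of_real_divide norm_scaleR)
  also have "norm (t *\<^sub>R X$1$2) < e / 4" 
    unfolding norm_scaleR using k'(1) t by (simp only: abs_of_pos mult.commute[of t])
  also have "norm ((1 / t) *\<^sub>R X$2$1) < e / 4"
    using k'(2) t by simp
  finally have "dist (offscale t X) (rdiag r) < e" using d1 d2 by linarith
  then have "offscale t X = rdiag r"
    using isolated offscale_mem[OF XH] t_def by blast
  then have "X$1$2 = 0" "X$2$1 = 0" using t by (auto simp: mat2_eq_iff)
  then show ?thesis by (simp add: monomial_def flip: X_def)
qed

text \<open>The left side of the last hypothesis is a contraction ratio: the step multiplies a
  parameter \<open>x\<close> with \<open>\<bar>x\<bar> \<le> \<bar>\<xi>\<bar>\<close> by at most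
  this factor in absolute value. After finitely many steps the smallness conditions hold.\<close>

lemma off_product_monomial:
  assumes "off_product B B' \<xi>" "B \<in> H" "B' \<in> H" and lt: "(r - 1 / r)\<^sup>2 * (1 + \<bar>\<xi>\<bar>) < 1"
  shows "monomial B"
proof -
  define K where "K = (r - 1 / r)\<^sup>2 * (1 + \<bar>\<xi>\<bar>)"
  have K: "0 \<le> K" "K < 1" using lt by (auto simp: K_def)
  \<comment> \<open>Induction on the number \<open>n\<close> of steps still to be made:
    \<open>K ^ n * \<bar>x\<bar>\<close> bounds the parameter reached after them. The premise
    \<open>\<bar>x\<bar> \<le> \<bar>\<xi>\<bar>\<close> is preserved and keeps the ratio
    \<open>K\<close> valid at every step.\<close>
  have iter: "monomial S"
    if "off_product S S' x" "S \<in> H" "S' \<in> H" "\<bar>x\<bar> \<le> \<bar>\<xi>\<bar>"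
      "K ^ n * \<bar>x\<bar> * \<bar>r - 1 / r\<bar> < e / 4" "K ^ n * \<bar>x\<bar> * (r\<^sup>2 + 1 / r\<^sup>2) < (e / 4)\<^sup>2"
    for n S S' x
    using that
  proof (induction n arbitrary: S S' x)
    case 0
    have "(r - 1 / r)\<^sup>2 * (1 + \<bar>x\<bar>) \<le> K"
      unfolding K_def using 0 by (intro mult_left_mono) auto
    then have "monomial (S ** rdiag r ** S')"
      using monomial_conj_rdiag_if_small 0 K by auto
    then show ?case using monomial_conj_rdiagD 0 r by blast
  next
    case (Suc n)
    let ?y = "- ((r - 1 / r)\<^sup>2 * x * (1 - x))"
    have "\<bar>?y\<bar> = (r - 1 / r)\<^sup>2 * \<bar>1 - x\<bar> * \<bar>x\<bar>"
      by (simp add: abs_mult mult.commute mult.left_commute)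
    also have "\<dots> \<le> K * \<bar>x\<bar>"
      unfolding K_def using Suc.prems(4) by (intro mult_right_mono mult_left_mono) auto
    finally have y: "\<bar>?y\<bar> \<le> K * \<bar>x\<bar>" .
    then have pw: "K ^ n * \<bar>?y\<bar> \<le> K ^ Suc n * \<bar>x\<bar>"
      using mult_left_mono[OF y, of "K ^ n"] K by (simp add: mult_ac)
    have "K * \<bar>x\<bar> \<le> \<bar>x\<bar>" using K by (simp add: mult_left_le_one_le)
    with y Suc.prems(4) have ylt: "\<bar>?y\<bar> \<le> \<bar>\<xi>\<bar>" by linarith
    have "K ^ n * \<bar>?y\<bar> * \<bar>r - 1 / r\<bar> < e / 4" "K ^ n * \<bar>?y\<bar> * (r\<^sup>2 + 1 / r\<^sup>2) < (e / 4)\<^sup>2"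
      using mult_right_mono[OF pw, of "\<bar>r - 1 / r\<bar>"] mult_right_mono[OF pw, of "r\<^sup>2 + 1 / r\<^sup>2"]
        Suc.prems(5,6) by auto
    then have "monomial (S ** rdiag r ** S')"
      using Suc.prems(1-3) r rdiag_mem
      by (intro Suc.IH[OF off_product_step[OF Suc.prems(1)] _ _ ylt]) (auto intro!: mult_closed)
    then show ?case using monomial_conj_rdiagD Suc.prems(1) r by blast
  qed
  have lim: "(\<lambda>n. K ^ n * \<bar>\<xi>\<bar> * c) \<longlonglongrightarrow> 0" for c
    using LIMSEQ_power_zero[of K] K by (auto intro!: tendsto_mult_left_zero)
  have "eventually (\<lambda>n. K ^ n * \<bar>\<xi>\<bar> * \<bar>r - 1 / r\<bar> < e / 4) sequentially"
    using e by (intro order_tendstoD(2)[OF lim]) auto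
  moreover have "eventually (\<lambda>n. K ^ n * \<bar>\<xi>\<bar> * (r\<^sup>2 + 1 / r\<^sup>2) < (e / 4)\<^sup>2) sequentially"
    using e by (intro order_tendstoD(2)[OF lim]) auto
  ultimately have "eventually (\<lambda>n. K ^ n * \<bar>\<xi>\<bar> * \<bar>r - 1 / r\<bar> < e / 4
      \<and> K ^ n * \<bar>\<xi>\<bar> * (r\<^sup>2 + 1 / r\<^sup>2) < (e / 4)\<^sup>2) sequentially"
    by (rule eventually_conj)
  then obtain n where "K ^ n * \<bar>\<xi>\<bar> * \<bar>r - 1 / r\<bar> < e / 4"
    "K ^ n * \<bar>\<xi>\<bar> * (r\<^sup>2 + 1 / r\<^sup>2) < (e / 4)\<^sup>2"
    by (auto simp: eventually_sequentially)
  then show ?thesis using iter assms(1-3) by blast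
qed

end

text \<open>The upper left entry of the sum is \<open>B$1$1 * B'$1$1\<close> taken twice plus
  \<open>r\<^sup>2 + 1 / r\<^sup>2\<close> times \<open>B$1$2 * B'$2$1\<close>. Using
  \<open>B ** B' = mat 1\<close>, this is 2 plus \<open>(r - 1 / r)\<^sup>2\<close> times the
  off-diagonal product, which is therefore real. The lower right entry gives the same value for the
  other product.\<close>

lemma commutator_rdiag_off_product:
  assumes inv: "B ** B' = mat 1" "B' ** B = mat 1" and r: "r \<notin> {0, 1, -1}"
    and t: "rdiag r ** B ** rdiag (1 / r) ** B' + B ** rdiag r ** B' ** rdiag (1 / r)
       = qdiag (of_real t) (of_real t)"
  shows "off_product B B' ((t - 2) / (r - 1 / r)\<^sup>2)"
proof -
  define b where "b = (r - 1 / r)\<^sup>2"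
  have b: "b = r\<^sup>2 + 1 / r\<^sup>2 - 2" "b \<noteq> 0"
  proof -
    show "b = r\<^sup>2 + 1 / r\<^sup>2 - 2"
      using r by (simp add: b_def power2_diff power_divide)
    have "r * (r - 1 / r) = (r - 1) * (r + 1)"
      using r by (simp add: field_simps)
    then show "b \<noteq> 0" using r by (auto simp: b_def)
  qed
  have "2 *\<^sub>R (B$1$1 * B'$1$1 + B$1$2 * B'$2$1) + b *\<^sub>R (B$1$2 * B'$2$1) = of_real t"
    using t r unfolding b
    by (simp add: mat2_eq_iff mat2_mult of_real_mult_quat mult_of_real_quat scaleR_left_diff_distrib
        scaleR_add_left scaleR_add_right power2_eq_square algebra_simps scaleR_2 del: of_real_divide)
  moreover have "2 *\<^sub>R (B$2$1 * B'$1$2 + B$2$2 * B'$2$2) + b *\<^sub>R (B$2$1 * B'$1$2) = of_real t"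
    using t r unfolding b
    by (simp add: mat2_eq_iff mat2_mult of_real_mult_quat mult_of_real_quat scaleR_left_diff_distrib
        scaleR_add_left scaleR_add_right power2_eq_square algebra_simps scaleR_2 del: of_real_divide)
  moreover have "B$1$1 * B'$1$1 + B$1$2 * B'$2$1 = 1" "B$2$1 * B'$1$2 + B$2$2 * B'$2$2 = 1"
    using inv by (simp_all add: mat2_eq_iff mat2_mult)
  ultimately have "b *\<^sub>R (B$1$2 * B'$2$1) = (t - 2) *\<^sub>R 1" "b *\<^sub>R (B$2$1 * B'$1$2) = (t - 2) *\<^sub>R 1"
    unfolding of_real_def by (simp_all add: scaleR_left_diff_distrib algebra_simps)
  then have "(1 / b) *\<^sub>R b *\<^sub>R (B$1$2 * B'$2$1) = (1 / b) *\<^sub>R (t - 2) *\<^sub>R 1"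
    "(1 / b) *\<^sub>R b *\<^sub>R (B$2$1 * B'$1$2) = (1 / b) *\<^sub>R (t - 2) *\<^sub>R 1"
    by simp_all
  then show ?thesis
    using inv b(2) by (simp add: off_product_def of_real_def flip: b_def)
qed

section \<open>The boundary action of conjugates of monomial matrices\<close>

text \<open>The boundary is the right projective line over the quaternions.\<close>

definition proj :: "quat^2 \<Rightarrow> quat option" where
  "proj v = (if v$2 = 0 then None else Some (v$1 * inverse (v$2)))"

lemma moebius_proj:
  assumes "v \<noteq> 0" "M *v v \<noteq> 0"
  shows "moebius M (proj v) = proj (M *v v)"
proof -
  have mv: "(M *v v)$i = M$i$1 * v$1 + M$i$2 * v$2" for i
    by (simp add: matrix_vector_mult_def sum_2)
  show ?thesis
  proof (cases "v$2 = 0")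
    case True
    then have v1: "v$1 \<noteq> 0" using assms(1) by (auto simp: vec_eq_iff forall_2)
    then have "v$1 * (inverse (v$1) * inverse (M$2$1)) = inverse (M$2$1)"
      by (simp flip: mult.assoc)
    with True v1 show ?thesis
      by (auto simp: moebius_def proj_def mv Let_def mult.assoc nonzero_inverse_mult_distrib)
  next
    case False
    \<comment> \<open>The affine coordinate arises from \<open>v\<close> by right multiplication
      with \<open>inverse (v$2)\<close>; this commutes with the left action of \<open>M\<close> and
      cancels in the quotient.\<close>
    have h: "M$i$1 * (v$1 * inverse (v$2)) + M$i$2 = (M *v v)$i * inverse (v$2)" for i
      using False by (simp add: mv distrib_right mult.assoc)
    have "x * inverse (v$2) * inverse (y * inverse (v$2)) = x * inverse y" if "y \<noteq> 0" for x y
      using False that by (simp add: nonzero_inverse_mult_distrib mult.assoc)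
        (simp flip: mult.assoc add: False)
    with False show ?thesis
      by (auto simp: moebius_def proj_def Let_def h)
  qed
qed

lemma monomial_mult: "monomial X \<Longrightarrow> monomial Y \<Longrightarrow> monomial (X ** Y)"
  by (auto simp: monomial_def mat2_mult)

lemma monomial_inverse:
  assumes "monomial X" "X ** Y = mat 1" "Y ** X = mat 1"
  shows "monomial Y"
  using assms by (auto simp: monomial_def mat2_eq_iff mat2_mult)

text \<open>In the basis of the columns of \<open>P\<close> the matrix acts as \<open>X\<close>,
  which sends the first basis vector to a right multiple of a basis vector; nonzero right multiples
  are the same projective point.\<close>

lemma moebius_monomial_conj:
  assumes P: "P ** P' = mat 1" "P' ** P = mat 1" and X: "X ** Y = mat 1" "Y ** X = mat 1" "monomial X"
  shows "moebius (P ** X ** P') (proj (column 1 P)) \<in> {proj (column 1 P), proj (column 2 P)}"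
proof -
  have col: "column 1 P = P *v axis 1 1"
    by (simp add: vec_eq_iff forall_2 matrix_vector_mult_def column_def axis_def sum_2)
  have nz: "U *v v \<noteq> 0" if "V ** U = mat 1" "v \<noteq> 0" for U V :: "quat^2^2" and v
    using that by (metis matrix_vector_mul_assoc matrix_vector_mul_lid matrix_vector_mult_0_right)
  have ax: "axis 1 1 \<noteq> (0 :: quat^2)" by (simp add: axis_eq_0_iff)
  have eq: "(P ** X ** P') *v (P *v v) = P *v (X *v v)" for v
    by (metis P(2) matrix_mul_assoc matrix_mul_rid matrix_vector_mul_assoc)
  have "moebius (P ** X ** P') (proj (P *v axis 1 1)) = proj (P *v (X *v axis 1 1))"
    using moebius_proj[OF nz[OF P(2) ax], of "P ** X ** P'"] nz[OF P(2) nz[OF X(2) ax]] by (simp add: eq)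
  moreover have "X *v axis 1 1 = (\<chi> i. X$i$1)"
    by (simp add: vec_eq_iff forall_2 matrix_vector_mult_def axis_def sum_2)
  moreover have "proj (P *v (\<chi> i. X$i$1)) \<in> {proj (column 1 P), proj (column 2 P)}"
  proof -
    have s: "proj (\<chi> i. v$i * l) = proj v" if "l \<noteq> 0" for v l
      using that by (auto simp: proj_def nonzero_inverse_mult_distrib mult.assoc)
        (simp flip: mult.assoc)
    have nz1: "X$1$1 \<noteq> 0 \<or> X$2$1 \<noteq> 0"
      using X(2) by (auto simp: mat2_eq_iff mat2_mult)
    show ?thesis
    proof (cases "X$2$1 = 0")
      case True
      then have "P *v (\<chi> i. X$i$1) = (\<chi> i. column 1 P $ i * X$1$1)"
        by (simp add: vec_eq_iff matrix_vector_mult_def sum_2 column_def)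
      then show ?thesis using s True nz1 by simp
    next
      case False
      then have "X$1$1 = 0" using X(3) by (auto simp: monomial_def)
      then have "P *v (\<chi> i. X$i$1) = (\<chi> i. column 2 P $ i * X$2$1)"
        by (simp add: vec_eq_iff matrix_vector_mult_def sum_2 column_def)
      then show ?thesis using s False by simp
    qed
  qed
  ultimately show ?thesis by (simp add: col)
qed


section \<open>Normal forms, discreteness and elementary groups\<close>

lemma strictly_hyperbolicE:
  assumes "strictly_hyperbolic M"
  obtains P P' r where "P ** P' = mat 1" "P' ** P = mat 1" "r \<notin> {0, 1, -1}" "M = P ** rdiag r ** P'"
proof -
  obtain P r s where P: "qdet P = 1" and d: "qdet (qdiag (of_real r) (of_real s)) = 1"
    and r: "r \<notin> {0, 1, -1}" "r * s > 0"
    and M: "M = P ** qdiag (of_real r) (of_real s) ** inv\<^bsub>SL2H\<^esub> P"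
    using assms unfolding strictly_hyperbolic_def by auto
  \<comment> \<open>The determinant only gives \<open>r * s\<close> up to sign; the condition
    \<open>r * s > 0\<close> selects \<open>s = 1 / r\<close>.\<close>
  have "(r * s)\<^sup>2 = 1"
    using d by (simp add: qdet_eq_1_iff power_mult_distrib)
  then have "r * s = 1" using r(2) by (auto simp: power2_eq_1_iff)
  then have "s = 1 / r" using r(1) by (simp add: field_simps)
  then show thesis
    using that[OF inv_SL2H(1,2)[OF P] r(1)] M by (simp add: rdiag_def)
qed

lemma delta_rdiag: "delta (rdiag r) = r + 1 / r"
  by (simp add: delta_def del: of_real_divide)

text \<open>\<open>rdiag t + rdiag (1 / t)\<close> is a real scalar matrix, hence central and
  unchanged by conjugation; the scalar \<open>t + 1 / t\<close> is the real trace of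
  \<open>C\<close>.\<close>

lemma add_inverse_of_rdiag_conj:
  assumes Q: "Q ** Q' = mat 1" "Q' ** Q = mat 1" and t: "t \<noteq> 0"
    and C: "C = Q ** rdiag t ** Q'" "C ** C' = mat 1"
  shows "C + C' = qdiag (of_real (delta C)) (of_real (delta C))"
proof -
  have "(Q ** rdiag (1 / t) ** Q') ** C = mat 1"
    unfolding C using inverse_conj[OF Q] rdiag_inverse[of "1 / t"] t by simp
  then have C': "C' = Q ** rdiag (1 / t) ** Q'"
    by (metis C(2) matrix_mul_assoc matrix_mul_lid matrix_mul_rid)
  have d: "delta C = t + 1 / t"
    unfolding C delta_conj[OF Q(2)] delta_rdiag ..
  have scalar: "qdiag (of_real x) (of_real x) ** X = X ** qdiag (of_real x) (of_real x)" for x X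
    by (simp add: mat2_eq_iff mat2_mult of_real_mult_quat mult_of_real_quat)
  have "rdiag t + rdiag (1 / t) = qdiag (of_real (t + 1 / t)) (of_real (t + 1 / t))"
    by (simp add: mat2_eq_iff)
  then have "C + C' = Q ** qdiag (of_real (t + 1 / t)) (of_real (t + 1 / t)) ** Q'"
    unfolding C(1) C' by (simp only: flip: matrix_add_ldistrib mat2_add_mult)
  also have "\<dots> = qdiag (of_real (t + 1 / t)) (of_real (t + 1 / t))"
    by (metis scalar Q(1) matrix_mul_assoc matrix_mul_rid)
  finally show ?thesis unfolding d .
qed

text \<open>Conjugation may distort distances, so isolation is transported through open sets:
  conjugation is continuous and injective.\<close>

lemma isolated_conj_preimage:
  fixes P P' :: "quat^2^2"
  assumes "discrete G" "P ** D ** P' \<in> G" and P: "P' ** P = mat 1" "P ** P' = mat 1"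
  shows "\<exists>e>0. \<forall>X. P ** X ** P' \<in> G \<longrightarrow> dist X D < e \<longrightarrow> X = D"
proof -
  let ?f = "\<lambda>X. P ** X ** P'"
  obtain T where T: "open T" "T \<inter> G = {?f D}"
    using assms(1,2) unfolding discrete_def isolated_in_def by blast
  have "continuous_on UNIV ?f"
    unfolding matrix_matrix_mult_def by (intro continuous_intros)
  then have "open (?f -` T)" using T(1) by (simp add: open_vimage)
  moreover have "D \<in> ?f -` T" using T(2) by auto
  ultimately obtain e where e: "e > 0" "\<And>X. dist X D < e \<Longrightarrow> ?f X \<in> T"
    unfolding open_dist by blast
  have inj: "X = D" if "?f X = ?f D" for X
    using that P by (metis matrix_mul_assoc matrix_mul_lid matrix_mul_rid)
  show ?thesis using e T(2) inj by blast
qed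

text \<open>Every group element is monomial in the basis given by \<open>P\<close>, so the orbit of
  the boundary point of its first column has at most two points.\<close>

lemma elementary_generate_if_monomial_conj:
  assumes "qdet A = 1" "qdet B = 1" and P: "P ** P' = mat 1" "P' ** P = mat 1"
    and A: "monomial (P' ** A ** P)" and B: "monomial (P' ** B ** P)"
  shows "elementary (generate SL2H {A, B})"
proof -
  \<comment> \<open>The inverse \<open>Y\<close> is carried along because invertibility of
    \<open>X\<close> keeps the image of a basis vector nonzero.\<close>
  have *: "\<exists>X Y. X ** Y = mat 1 \<and> Y ** X = mat 1 \<and> monomial X \<and> M = P ** X ** P'"
    if "M \<in> generate SL2H {A, B}" for M
    using that
  proof induction
    case one
    have "monomial (mat 1)" by (simp add: monomial_def)
    moreover have "P ** mat 1 ** P' = mat 1" using P by simp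
    ultimately show ?case by (metis SL2H_simps(3) matrix_mul_lid)
  next
    case (incl M)
    then have "qdet M = 1" "monomial (P' ** M ** P)" using assms by auto
    moreover have "M = P ** (P' ** M ** P) ** P'"
      by (metis P(1) matrix_mul_assoc matrix_mul_lid matrix_mul_rid)
    ultimately show ?case using inverse_conj[OF P(2,1)] inv_SL2H by metis
  next
    case (inv M)
    then have M: "qdet M = 1" "monomial (P' ** M ** P)" using assms by auto
    let ?N = "inv\<^bsub>SL2H\<^esub> M"
    have e: "?N = P ** (P' ** ?N ** P) ** P'"
      by (metis P(1) matrix_mul_assoc matrix_mul_lid matrix_mul_rid)
    have i: "(P' ** ?N ** P) ** (P' ** M ** P) = mat 1" "(P' ** M ** P) ** (P' ** ?N ** P) = mat 1"
      using inverse_conj[OF P(2,1)] inv_SL2H[OF M(1)] by blast+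
    show ?case using e i monomial_inverse[OF M(2) i(2,1)] by blast
  next
    case (eng M N)
    then obtain X Y Z W where
      1: "X ** Y = mat 1" "Y ** X = mat 1" "monomial X" "M = P ** X ** P'" and
      2: "Z ** W = mat 1" "W ** Z = mat 1" "monomial Z" "N = P ** Z ** P'" by blast
    have "M \<otimes>\<^bsub>SL2H\<^esub> N = P ** (X ** Z) ** P'"
      unfolding 1 2 SL2H_simps by (metis P(2) matrix_mul_assoc matrix_mul_rid)
    moreover have "(X ** Z) ** (W ** Y) = mat 1" "(W ** Y) ** (X ** Z) = mat 1"
      by (metis 1(1,2) 2(1,2) matrix_mul_assoc matrix_mul_rid)+
    ultimately show ?case using monomial_mult[OF 1(3) 2(3)] by blast
  qed
  have "(\<lambda>M. moebius M (proj (column 1 P))) ` generate SL2H {A, B}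
      \<subseteq> {proj (column 1 P), proj (column 2 P)}"
    using * moebius_monomial_conj[OF P] by blast
  then have "finite ((\<lambda>M. moebius M (proj (column 1 P))) ` generate SL2H {A, B})"
    by (rule finite_subset) simp
  then show ?thesis unfolding elementary_def by blast
qed

section \<open>Reduction to a diagonal first generator\<close>

theorem corollary3p4:
  fixes A B :: "quat^2^2"
  assumes "A \<in> carrier SL2H" and "B \<in> carrier SL2H"
    and "strictly_hyperbolic A" and "strictly_hyperbolic (commutator A B)"
    and "\<not> elementary (generate SL2H {A, B})"
    and "discrete (generate SL2H {A, B})"
  shows "\<bar>(delta A)\<^sup>2 - 4\<bar> + \<bar>delta (commutator A B) - 2\<bar> \<ge> 1"
proof (rule ccontr)
  assume "\<not> ?thesis"
  then have small: "\<bar>(delta A)\<^sup>2 - 4\<bar> + \<bar>delta (commutator A B) - 2\<bar> < 1" by simp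
  define A' B' where "A' = inv\<^bsub>SL2H\<^esub> A" and "B' = inv\<^bsub>SL2H\<^esub> B"
  have dets: "qdet A = 1" "qdet B = 1" using assms(1,2) by auto
  note invs = inv_SL2H(1,2)[OF dets(1), folded A'_def] inv_SL2H(1,2)[OF dets(2), folded B'_def]
  obtain P P' r where P: "P ** P' = mat 1" "P' ** P = mat 1"
    and r: "r \<notin> {0, 1, -1}" and A: "A = P ** rdiag r ** P'"
    using strictly_hyperbolicE[OF assms(3)] .
  define C where "C = commutator A B"
  have C: "C = A ** B ** A' ** B'" by (simp add: C_def commutator_def A'_def B'_def)
  \<comment> \<open>The inverse of \<open>C\<close>, so that \<open>C + D\<close> is a real scalar
    matrix.\<close>
  define D where "D = B ** A ** B' ** A'"
  obtain Q Q' t where Q: "Q ** Q' = mat 1" "Q' ** Q = mat 1" "t \<notin> {0, 1, -1}" "C = Q ** rdiag t ** Q'"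
    using strictly_hyperbolicE[OF assms(4)] unfolding C_def .
  have "C ** D = A ** (B ** (A' ** ((B' ** B) ** A)) ** B') ** A'"
    unfolding C D_def by (simp only: matrix_mul_assoc)
  then have "C ** D = mat 1" by (simp add: invs)
  then have CD: "C + D = qdiag (of_real (delta C)) (of_real (delta C))"
    using add_inverse_of_rdiag_conj[OF Q(1,2) _ Q(4)] Q(3) by blast
  \<comment> \<open>\<open>B\<close> and its inverse in the coordinates in which \<open>A\<close>
    becomes \<open>rdiag r\<close>.\<close>
  define X X' where "X = P' ** B ** P" and "X' = P' ** B' ** P"
  have X: "X ** X' = mat 1" "X' ** X = mat 1"
    unfolding X_def X'_def using inverse_conj[OF P(2,1)] invs by blast+
  have A'_eq: "A' = P ** rdiag (1 / r) ** P'"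
    unfolding A'_def
    by (rule inv_SL2H_eqI[OF dets(1)])
      (use A inverse_conj[OF P] rdiag_inverse[of r] rdiag_inverse[of "1 / r"] r in auto)
  have canc: "P' ** (P ** Z) = Z" "P ** (P' ** Z) = Z" for Z
    by (simp_all add: matrix_mul_assoc P)
  have PX: "P ** X ** P' = B" "P ** X' ** P' = B'"
    by (simp_all add: X_def X'_def canc P flip: matrix_mul_assoc)
  have "rdiag r ** X ** rdiag (1 / r) ** X' + X ** rdiag r ** X' ** rdiag (1 / r)
      = P' ** (C + D) ** P"
    unfolding C D_def A A'_eq matrix_add_ldistrib mat2_add_mult X_def X'_def
    by (simp add: canc P flip: matrix_mul_assoc)
  also have "\<dots> = P' ** P ** qdiag (of_real (delta C)) (of_real (delta C))"
    unfolding CD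
    by (simp add: mat2_eq_iff mat2_mult of_real_mult_quat mult_of_real_quat algebra_simps)
  finally have "off_product X X' ((delta C - 2) / (r - 1 / r)\<^sup>2)"
    by (intro commutator_rdiag_off_product[OF X r]) (simp add: P)
  \<comment> \<open>Since \<open>(delta A)\<^sup>2 - 4\<close> equals
    \<open>(r - 1 / r)\<^sup>2\<close>, multiplying out gives exactly the sum assumed to be less
    than 1.\<close>
  moreover have "(r - 1 / r)\<^sup>2 * (1 + \<bar>(delta C - 2) / (r - 1 / r)\<^sup>2\<bar>) < 1"
  proof -
    have "(delta A)\<^sup>2 - 4 = (r - 1 / r)\<^sup>2"
      unfolding A delta_conj[OF P(2)] delta_rdiag using r
      by (simp add: power2_sum power2_diff)
    moreover have "(r - 1 / r)\<^sup>2 \<noteq> 0"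
      using r by (auto simp: field_simps power2_eq_1_iff simp flip: power2_eq_square)
    ultimately show ?thesis using small by (simp add: C_def distrib_left)
  qed
  \<comment> \<open>The iteration runs in the group conjugated by \<open>P\<close>, where
    discreteness isolates \<open>rdiag r\<close>, the image of \<open>A\<close>.\<close>
  moreover have "monomial X" if "off_product X X' \<xi>" "(r - 1 / r)\<^sup>2 * (1 + \<bar>\<xi>\<bar>) < 1" for \<xi>
  proof -
    let ?G = "generate SL2H {A, B}"
    have gens: "A \<in> ?G" "B \<in> ?G" "A' \<in> ?G" "B' \<in> ?G"
      unfolding A'_def B'_def by (auto intro: generate.incl generate.inv)
    obtain e where e: "e > 0" "\<And>Y. P ** Y ** P' \<in> ?G \<Longrightarrow> dist Y (rdiag r) < e \<Longrightarrow> Y = rdiag r"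
      using isolated_conj_preimage[OF assms(6) _ P(2,1)] gens(1) A by blast
    have "P ** (Y ** Z) ** P' \<in> ?G" if "P ** Y ** P' \<in> ?G" "P ** Z ** P' \<in> ?G" for Y Z
    proof -
      have "P ** (Y ** Z) ** P' = (P ** Y ** P') ** (P ** Z ** P')"
        by (simp add: canc flip: matrix_mul_assoc)
      then show ?thesis using generate.eng[OF that] by simp
    qed
    then show ?thesis
      using off_product_monomial[of "{Y. P ** Y ** P' \<in> ?G}" r e X X' \<xi>] e r that gens
      by (simp add: PX flip: A A'_eq)
  qed
  ultimately have "monomial (P' ** B ** P)" by (simp add: X_def)
  moreover have "P' ** A ** P = rdiag r"
    by (simp add: A canc P flip: matrix_mul_assoc)
  then have "monomial (P' ** A ** P)" by (simp add: monomial_def)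
  ultimately show False
    using elementary_generate_if_monomial_conj[OF dets P] assms(5) by blast
qed

end
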